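(* Let $X$ be a real Banach space and let $\kappa$ be an infinite cardinal. Then: (1) $X$ is $\mathrm{SQ}_{<\kappa}$ if and only if $X\times\{0\}$ is a $\kappa$ isometric ideal in $X\oplus_\infty\mathbb R$. (2) $X$ is $<\kappa$-octahedral if and only if $X\times\{0\}$ is a $\kappa$ almost isometric ideal in $X\oplus_1\mathbb R$. (3) $X$ fails the $(-1)$-$\mathrm{BCP}_{<\kappa}$ if and only if $X\times\{0\}$ is a $\kappa$ isometric ideal in $X\oplus_1\mathbb R$.
   Context: For a normed space $Z$, $\operatorname{dens}(Z)$ is the least cardinality of a subset of $Z$ whose linear span is dense in $Z$ (so it equals $\dim Z$ if $Z$ is finite dimensional); $S_Z$ is its unit sphere. $X\oplus_\infty\mathbb R$ and $X\oplus_1\mathbb R$ are $X\times\mathbb R$ with norms $\max\{\|x\|,|\lambda|\}$ and $\|x\|+|\lambda|$ respectively. A subspace $Y$ of a Banach space $W$ is a $\kappa$ isometric ideal (resp. $\kappa$ almost isometric ideal) in $W$ if for every subspace $E\subseteq W$ with $\operatorname{dens}(E)<\kappa$ (resp. and every $\varepsilon>0$) there is a linear operator $T:E\to Y$ with $T(e)=e$ for all $e\in E\cap Y$ and $\|T(e)\|=\|e\|$ (resp. $(1-\varepsilon)\|e\|\le\|T(e)\|\le(1+\varepsilon)\|e\|$) for all $e\in E$. $X$ is $\mathrm{SQ}_{<\kappa}$ ($<\kappa$-square) if for every subspace $Z\subseteq X$ with $\operatorname{dens}(Z)<\kappa$ there is $x\in S_X$ with $\|z+\lambda x\|\le\max\{\|z\|,|\lambda|\}$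 for all $z\in Z$, $\lambda\in\mathbb R$. $X$ is $<\kappa$-octahedral if for every subspace $Z\subseteq X$ with $\operatorname{dens}(Z)<\kappa$ and every $\varepsilon>0$ there is $x\in S_X$ with $\|z+\lambda x\|\ge(1-\varepsilon)(\|z\|+|\lambda|)$ for all $z\in Z$, $\lambda\in\mathbb R$. $X$ fails the $(-1)$-$\mathrm{BCP}_{<\kappa}$ if for every subspace $Z\subseteq X$ with $\operatorname{dens}(Z)<\kappa$ there is $x\in S_X$ with $\|z+\lambda x\|=\|z\|+|\lambda|$ for all $z\in Z$, $\lambda\in\mathbb R$. *)

theory Defs
  imports "HOL-Analysis.Analysis"
begin

unbundle cardinal_syntax

text \<open>
  The library's product type carries the Euclidean norm, so the sums
  \<open>X \<oplus>\<^sub>\<infinity> Y\<close> and \<open>X \<oplus>\<^sub>1 Y\<close> are introduced as separate types. Only the norm differs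
  from the componentwise structure; the metric, uniformity and topology are induced by it.
\<close>

datatype ('a, 'b) linf_sum = Linf (linf_fst: 'a) (linf_snd: 'b)

instantiation linf_sum :: (real_normed_vector, real_normed_vector) real_normed_vector
begin

definition "0 = Linf 0 0"
definition "p + q = Linf (linf_fst p + linf_fst q) (linf_snd p + linf_snd q)"
definition "- p = Linf (- linf_fst p) (- linf_snd p)"
definition "p - q = Linf (linf_fst p - linf_fst q) (linf_snd p - linf_snd q)"
definition "r *\<^sub>R p = Linf (r *\<^sub>R linf_fst p) (r *\<^sub>R linf_snd p)"
definition "norm p = max (norm (linf_fst p)) (norm (linf_snd p))"
definition "sgn p = inverse (norm p) *\<^sub>R p" for p :: "('a, 'b) linf_sum"
definition "dist p q = norm (p - q)" for p q :: "('a, 'b) linf_sum"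
definition "uniformity = (INF e\<in>{0<..}. principal {(p, q :: ('a, 'b) linf_sum). dist p q < e})"
definition "open U = (\<forall>p\<in>U. eventually (\<lambda>(p', q). p' = p \<longrightarrow> q \<in> U) uniformity)"
  for U :: "('a, 'b) linf_sum set"

instance
proof
  fix p q :: "('a, 'b) linf_sum" and r :: real
  show "norm (p + q) \<le> norm p + norm q"
    using norm_triangle_ineq[of "linf_fst p" "linf_fst q"] norm_triangle_ineq[of "linf_snd p" "linf_snd q"]
    by (auto simp: norm_linf_sum_def plus_linf_sum_def)
  show "norm (r *\<^sub>R p) = \<bar>r\<bar> * norm p"
    by (simp add: norm_linf_sum_def scaleR_linf_sum_def max_mult_distrib_left)
  show "norm p = 0 \<longleftrightarrow> p = 0"
    by (cases p) (auto simp: norm_linf_sum_def zero_linf_sum_def max_def split: if_splits)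
qed (simp_all add: zero_linf_sum_def plus_linf_sum_def uminus_linf_sum_def minus_linf_sum_def
      scaleR_linf_sum_def sgn_linf_sum_def dist_linf_sum_def scaleR_add_left scaleR_add_right
      open_linf_sum_def uniformity_linf_sum_def add.assoc)

end

instance linf_sum :: (banach, banach) banach
proof
  fix P :: "nat \<Rightarrow> ('a, 'b) linf_sum"
  assume P: "Cauchy P"
  have "dist (linf_fst p) (linf_fst q) \<le> dist p q" "dist (linf_snd p) (linf_snd q) \<le> dist p q"
    for p q :: "('a, 'b) linf_sum"
    by (auto simp: dist_linf_sum_def dist_norm norm_linf_sum_def minus_linf_sum_def)
  note le = this
  have "Cauchy (\<lambda>n. linf_fst (P n))"
    by (rule metric_CauchyI, drule metric_CauchyD[OF P]) (meson le(1) le_less_trans)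
  moreover have "Cauchy (\<lambda>n. linf_snd (P n))"
    by (rule metric_CauchyI, drule metric_CauchyD[OF P]) (meson le(2) le_less_trans)
  ultimately obtain x y
    where x: "(\<lambda>n. linf_fst (P n)) \<longlonglongrightarrow> x" and y: "(\<lambda>n. linf_snd (P n)) \<longlonglongrightarrow> y"
    using Cauchy_convergent convergent_def by metis
  note lim = tendsto_norm_zero[OF LIM_zero[OF x]] tendsto_norm_zero[OF LIM_zero[OF y]]
  have eq: "norm (P n - Linf x y) = max (norm (linf_fst (P n) - x)) (norm (linf_snd (P n) - y))" for n
    by (simp add: norm_linf_sum_def minus_linf_sum_def)
  have "(\<lambda>n. norm (P n - Linf x y)) \<longlonglongrightarrow> 0"
    unfolding eq using tendsto_max[OF lim] by (simp only: max.idem)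
  then have "P \<longlonglongrightarrow> Linf x y"
    by (rule LIM_zero_cancel[OF tendsto_norm_zero_cancel])
  then show "convergent P"
    by (rule convergentI)
qed

datatype ('a, 'b) l1_sum = L1 (l1_fst: 'a) (l1_snd: 'b)

instantiation l1_sum :: (real_normed_vector, real_normed_vector) real_normed_vector
begin

definition "0 = L1 0 0"
definition "p + q = L1 (l1_fst p + l1_fst q) (l1_snd p + l1_snd q)"
definition "- p = L1 (- l1_fst p) (- l1_snd p)"
definition "p - q = L1 (l1_fst p - l1_fst q) (l1_snd p - l1_snd q)"
definition "r *\<^sub>R p = L1 (r *\<^sub>R l1_fst p) (r *\<^sub>R l1_snd p)"
definition "norm p = norm (l1_fst p) + norm (l1_snd p)"
definition "sgn p = inverse (norm p) *\<^sub>R p" for p :: "('a, 'b) l1_sum"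
definition "dist p q = norm (p - q)" for p q :: "('a, 'b) l1_sum"
definition "uniformity = (INF e\<in>{0<..}. principal {(p, q :: ('a, 'b) l1_sum). dist p q < e})"
definition "open U = (\<forall>p\<in>U. eventually (\<lambda>(p', q). p' = p \<longrightarrow> q \<in> U) uniformity)"
  for U :: "('a, 'b) l1_sum set"

instance
proof
  fix p q :: "('a, 'b) l1_sum" and r :: real
  show "norm (p + q) \<le> norm p + norm q"
    using norm_triangle_ineq[of "l1_fst p" "l1_fst q"] norm_triangle_ineq[of "l1_snd p" "l1_snd q"]
    by (auto simp: norm_l1_sum_def plus_l1_sum_def)
  show "norm (r *\<^sub>R p) = \<bar>r\<bar> * norm p"
    by (simp add: norm_l1_sum_def scaleR_l1_sum_def distrib_left)
  show "norm p = 0 \<longleftrightarrow> p = 0"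
    by (cases p) (simp add: norm_l1_sum_def zero_l1_sum_def add_nonneg_eq_0_iff)
qed (simp_all add: zero_l1_sum_def plus_l1_sum_def uminus_l1_sum_def minus_l1_sum_def
      scaleR_l1_sum_def sgn_l1_sum_def dist_l1_sum_def scaleR_add_left scaleR_add_right
      open_l1_sum_def uniformity_l1_sum_def add.assoc)

end

instance l1_sum :: (banach, banach) banach
proof
  fix P :: "nat \<Rightarrow> ('a, 'b) l1_sum"
  assume P: "Cauchy P"
  have "dist (l1_fst p) (l1_fst q) \<le> dist p q" "dist (l1_snd p) (l1_snd q) \<le> dist p q"
    for p q :: "('a, 'b) l1_sum"
    by (auto simp: dist_l1_sum_def dist_norm norm_l1_sum_def minus_l1_sum_def)
  note le = this
  have "Cauchy (\<lambda>n. l1_fst (P n))"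
    by (rule metric_CauchyI, drule metric_CauchyD[OF P]) (meson le(1) le_less_trans)
  moreover have "Cauchy (\<lambda>n. l1_snd (P n))"
    by (rule metric_CauchyI, drule metric_CauchyD[OF P]) (meson le(2) le_less_trans)
  ultimately obtain x y
    where x: "(\<lambda>n. l1_fst (P n)) \<longlonglongrightarrow> x" and y: "(\<lambda>n. l1_snd (P n)) \<longlonglongrightarrow> y"
    using Cauchy_convergent convergent_def by metis
  note lim = tendsto_norm_zero[OF LIM_zero[OF x]] tendsto_norm_zero[OF LIM_zero[OF y]]
  have eq: "norm (P n - L1 x y) = norm (l1_fst (P n) - x) + norm (l1_snd (P n) - y)" for n
    by (simp add: norm_l1_sum_def minus_l1_sum_def)
  have "(\<lambda>n. norm (P n - L1 x y)) \<longlonglongrightarrow> 0"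
    unfolding eq using tendsto_add[OF lim] by (simp only: add_0)
  then have "P \<longlonglongrightarrow> L1 x y"
    by (rule LIM_zero_cancel[OF tendsto_norm_zero_cancel])
  then show "convergent P"
    by (rule convergentI)
qed

text \<open>
  \<open>dens Z\<close> is a least cardinal, represented as in the library by the canonical
  well-order on a set \<open>B\<close> realising it. The choice always succeeds, see
  \<open>dens_less_iff\<close>.
\<close>

definition dens :: "'a::real_normed_vector set \<Rightarrow> 'a rel" where
  "dens Z = |SOME B. B \<subseteq> Z \<and> Z \<subseteq> closure (span B) \<and>
                 (\<forall>B'. B' \<subseteq> Z \<and> Z \<subseteq> closure (span B') \<longrightarrow> |B| \<le>o |B'| )|"

lemma dens_less_iff:
  "dens Z <o \<kappa> \<longleftrightarrow> (\<exists>B. B \<subseteq> Z \<and> Z \<subseteq> closure (span B) \<and> |B| <o \<kappa>)"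
proof -
  let ?G = "\<lambda>B. B \<subseteq> Z \<and> Z \<subseteq> closure (span B)"
  have "?G Z"
    using span_superset closure_subset by blast
  then have "\<exists>r\<in>card_of ` Collect ?G. \<forall>r'\<in>card_of ` Collect ?G. r \<le>o r'"
    by (intro exists_minim_Card_order) (auto simp: card_of_Card_order)
  then have "\<exists>B. B \<subseteq> Z \<and> Z \<subseteq> closure (span B) \<and> (\<forall>B'. ?G B' \<longrightarrow> |B| \<le>o |B'| )"
    by auto
  from someI_ex[OF this] obtain B
    where B: "?G B" "\<forall>B'. ?G B' \<longrightarrow> |B| \<le>o |B'|" and "dens Z = |B|"
    unfolding dens_def by blast
  then show ?thesis
    by (metis ordLeq_ordLess_trans)
qed

definition linear_map_on ::
    "'a::real_vector set \<Rightarrow> ('a \<Rightarrow> 'b::real_vector) \<Rightarrow> bool" where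
  "linear_map_on E T \<longleftrightarrow>
     (\<forall>x\<in>E. \<forall>y\<in>E. T (x + y) = T x + T y) \<and> (\<forall>r. \<forall>x\<in>E. T (r *\<^sub>R x) = r *\<^sub>R T x)"

text \<open>
  In the definitions below the ambient space is the whole type, and subspaces are linear
  subspaces, not required to be closed. Operators on \<open>E\<close> are total functions of which
  only the values on \<open>E\<close> matter.
\<close>

definition isometric_ideal :: "'k rel \<Rightarrow> 'w::banach set \<Rightarrow> bool" where
  "isometric_ideal \<kappa> Y \<longleftrightarrow> subspace Y \<and>
     (\<forall>E. subspace E \<and> dens E <o \<kappa> \<longrightarrow>
       (\<exists>T. linear_map_on E T \<and> T ` E \<subseteq> Y \<and> (\<forall>e\<in>E \<inter> Y. T e = e) \<and>
            (\<forall>e\<in>E. norm (T e) = norm e)))"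

definition almost_isometric_ideal :: "'k rel \<Rightarrow> 'w::banach set \<Rightarrow> bool" where
  "almost_isometric_ideal \<kappa> Y \<longleftrightarrow> subspace Y \<and>
     (\<forall>E. \<forall>\<epsilon>>0. subspace E \<and> dens E <o \<kappa> \<longrightarrow>
       (\<exists>T. linear_map_on E T \<and> T ` E \<subseteq> Y \<and> (\<forall>e\<in>E \<inter> Y. T e = e) \<and>
            (\<forall>e\<in>E. (1 - \<epsilon>) * norm e \<le> norm (T e) \<and> norm (T e) \<le> (1 + \<epsilon>) * norm e)))"

definition SQ_less :: "'a::banach itself \<Rightarrow> 'k rel \<Rightarrow> bool" where
  "SQ_less (_ :: 'a itself) \<kappa> \<longleftrightarrow>
     (\<forall>Z :: 'a set. subspace Z \<and> dens Z <o \<kappa> \<longrightarrow>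
       (\<exists>x\<in>sphere 0 1. \<forall>z\<in>Z. \<forall>c::real. norm (z + c *\<^sub>R x) \<le> max (norm z) \<bar>c\<bar>))"

definition octahedral_less :: "'a::banach itself \<Rightarrow> 'k rel \<Rightarrow> bool" where
  "octahedral_less (_ :: 'a itself) \<kappa> \<longleftrightarrow>
     (\<forall>Z :: 'a set. \<forall>\<epsilon>>0. subspace Z \<and> dens Z <o \<kappa> \<longrightarrow>
       (\<exists>x\<in>sphere 0 1. \<forall>z\<in>Z. \<forall>c::real.
          norm (z + c *\<^sub>R x) \<ge> (1 - \<epsilon>) * (norm z + \<bar>c\<bar>)))"

definition fails_minus_one_BCP_less :: "'a::banach itself \<Rightarrow> 'k rel \<Rightarrow> bool" where
  "fails_minus_one_BCP_less (_ :: 'a itself) \<kappa> \<longleftrightarrow>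
     (\<forall>Z :: 'a set. subspace Z \<and> dens Z <o \<kappa> \<longrightarrow>
       (\<exists>x\<in>sphere 0 1. \<forall>z\<in>Z. \<forall>c::real. norm (z + c *\<^sub>R x) = norm z + \<bar>c\<bar>))"

end

theory Submission
  imports Defs
begin

text \<open>
  In each sum \<open>W\<close> of \<open>X\<close> with a line, every vector is \<open>J z + c v\<close>, where \<open>J\<close> embeds \<open>X\<close> and
  \<open>v\<close> spans the added line. An operator into \<open>J X\<close> that fixes the part of its domain lying in
  \<open>J X\<close> has no freedom except for the image \<open>J x\<close> of \<open>v\<close>: it must send \<open>J z + c v\<close> to
  \<open>J (z + c x)\<close>. So finding an (almost) isometric operator amounts to finding a vector \<open>x\<close> for
  which \<open>\<parallel>z + c x\<parallel>\<close> is (almost) \<open>\<parallel>J z + c v\<parallel>\<close>. The subspaces \<open>E\<close> of \<open>W\<close> and \<open>Z\<close> of \<open>X\<close> over which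
  one quantifies correspond to each other: from \<open>E\<close> one passes to its projection to \<open>X\<close>, and
  from \<open>Z\<close> to \<open>J Z + \<real> v\<close>, and neither passage takes the density out of the range below an
  infinite cardinal. This is \<open>ideal_iff_vector\<close>.

  It remains to compare the conditions on \<open>x\<close> with those in the three definitions. For
  \<open>(-1)\<close>-BCP they agree up to \<open>\<parallel>x\<parallel> = 1\<close>, which is the case \<open>z = 0\<close>, \<open>c = 1\<close>. For squareness, the
  upper bound \<open>max \<parallel>z\<parallel> \<bar>c\<bar>\<close> on both \<open>\<parallel>z + c x\<parallel>\<close> and \<open>\<parallel>z - c x\<parallel>\<close> forces equality, because the
  sum of these vectors is \<open>2 z\<close> and their difference is \<open>2 c x\<close> (\<open>norm_eq_max\<close>). For octahedrality,
  the upper estimate is the triangle inequality, and in the other direction \<open>x\<close> has norm close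
  to \<open>1\<close> and is normalised at the cost of a smaller \<open>\<epsilon>\<close> (\<open>normalize_l1_vector\<close>).
\<close>

section \<open>Density below a cardinal\<close>

lemma dens_image_less:
  assumes g: "bounded_linear g" and "dens E <o \<kappa>"
  shows "dens (g ` E) <o \<kappa>"
proof -
  interpret g: bounded_linear g by (rule g)
  obtain B where B: "B \<subseteq> E" "E \<subseteq> closure (span B)" "|B| <o \<kappa>"
    using assms(2) dens_less_iff by blast
  have "g ` E \<subseteq> g ` closure (span B)"
    using B(2) by blast
  also have "\<dots> \<subseteq> closure (g ` span B)"
    by (rule closure_bounded_linear_image_subset[OF g])
  also have "g ` span B = span (g ` B)"
    by (rule linear_span_image[OF g.linear_axioms, symmetric])
  finally have "g ` E \<subseteq> closure (span (g ` B))" .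
  moreover have "|g ` B| <o \<kappa>"
    using card_of_image B(3) by (rule ordLeq_ordLess_trans)
  ultimately show ?thesis
    using B(1) dens_less_iff by (metis image_mono)
qed

lemma card_of_insert_less:
  assumes "Card_order \<kappa>" "infinite (Field \<kappa>)" "|B| <o \<kappa>"
  shows "|insert b B| <o \<kappa>"
proof -
  have "|{b}| <o \<kappa>"
    using finite_ordLess_infinite[OF card_of_Well_order, of \<kappa> "{b}"] assms
    by (simp add: card_order_on_well_order_on Field_card_of)
  from card_of_Un_ordLess_infinite_Field[OF assms(2,1) this assms(3)] show ?thesis
    by simp
qed

lemma subspace_closure:
  fixes S :: "'a::real_normed_vector set"
  assumes "subspace S"
  shows "subspace (closure S)"
proof (rule subspaceI)
  show "0 \<in> closure S"
    using subspace_0[OF assms] closure_subset by blast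
next
  fix x y assume "x \<in> closure S" "y \<in> closure S"
  then obtain f g where fg: "\<And>n. f n \<in> S" "\<And>n. g n \<in> S" "f \<longlonglongrightarrow> x" "g \<longlonglongrightarrow> y"
    by (metis closure_sequential)
  then have "(\<lambda>n. f n + g n) \<longlonglongrightarrow> x + y" "\<And>n. f n + g n \<in> S"
    by (auto intro: tendsto_add subspace_add[OF assms])
  then show "x + y \<in> closure S"
    unfolding closure_sequential by (intro exI[of _ "\<lambda>n. f n + g n"]) simp
next
  fix c :: real and x assume "x \<in> closure S"
  then obtain f where "\<And>n. f n \<in> S" "f \<longlonglongrightarrow> x"
    by (metis closure_sequential)
  then have "(\<lambda>n. c *\<^sub>R f n) \<longlonglongrightarrow> c *\<^sub>R x" "\<And>n. c *\<^sub>R f n \<in> S"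
    by (auto intro: tendsto_scaleR subspace_scale[OF assms])
  then show "c *\<^sub>R x \<in> closure S"
    unfolding closure_sequential by (intro exI[of _ "\<lambda>n. c *\<^sub>R f n"]) simp
qed

lemma dens_add_line_less:
  assumes "Card_order \<kappa>" "infinite (Field \<kappa>)" "dens Z <o \<kappa>" "0 \<in> Z"
  shows "dens {z + c *\<^sub>R v | z c. z \<in> Z} <o \<kappa>"
proof -
  let ?E = "{z + c *\<^sub>R v | z c. z \<in> Z}"
  obtain B where B: "B \<subseteq> Z" "Z \<subseteq> closure (span B)" "|B| <o \<kappa>"
    using assms(3) dens_less_iff by blast
  let ?C = "closure (span (insert v B))"
  have "Z \<subseteq> ?C"
    using B(2) closure_mono[OF span_mono[OF subset_insertI]] by blast
  moreover have "v \<in> ?C"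
    by (meson closure_subset insertI1 span_base subsetD)
  moreover have "subspace ?C"
    by (intro subspace_closure subspace_span)
  ultimately have "?E \<subseteq> ?C"
    by (auto intro!: subspace_add subspace_scale)
  moreover have "insert v B \<subseteq> ?E"
  proof -
    have "v = 0 + 1 *\<^sub>R v" by simp
    moreover have "b = b + 0 *\<^sub>R v" for b by simp
    ultimately show ?thesis
      using B(1) assms(4) by blast
  qed
  ultimately show ?thesis
    using dens_less_iff card_of_insert_less[OF assms(1,2) B(3)] by blast
qed

section \<open>Ideals of codimension one\<close>

text \<open>
  \<open>P\<close> and \<open>q\<close> are the coordinates of the decomposition \<open>W = J X \<oplus> \<real> v\<close>. The norm
  of \<open>W\<close> is tied to that of \<open>X\<close> only through \<open>J\<close> being isometric and \<open>P\<close> bounded, so that the same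
  argument covers both sums.
\<close>

locale line_extension =
  fixes J :: "'a::real_normed_vector \<Rightarrow> 'w::real_normed_vector" and v :: 'w
    and P :: "'w \<Rightarrow> 'a" and q :: "'w \<Rightarrow> real"
  assumes linear_J: "linear J" and norm_J: "norm (J x) = norm x"
    and bounded_linear_P: "bounded_linear P" and linear_q: "linear q"
    and P_J: "P (J x) = x" and q_J: "q (J x) = 0"
    and decomp: "J (P w) + q w *\<^sub>R v = w"
begin

interpretation J: linear J by (rule linear_J)
interpretation P: bounded_linear P by (rule bounded_linear_P)
interpretation q: linear q by (rule linear_q)

lemma bounded_linear_J: "bounded_linear J"
  by (rule bounded_linear_intro[where K = 1]) (simp_all add: J.add J.scale norm_J)

text \<open>
  The relation \<open>R\<close> between the norm of an image and the norm of its argument is arbitrary: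
  equality gives isometric ideals, and the two-sided \<open>\<epsilon>\<close>-estimate gives almost isometric ones.
\<close>

lemma ideal_iff_vector:
  assumes "Card_order \<kappa>" "infinite (Field \<kappa>)"
  shows "(\<forall>E. subspace E \<and> dens E <o \<kappa> \<longrightarrow>
           (\<exists>T. linear_map_on E T \<and> T ` E \<subseteq> range J \<and> (\<forall>e\<in>E \<inter> range J. T e = e) \<and>
                (\<forall>e\<in>E. R (norm (T e)) (norm e)))) \<longleftrightarrow>
         (\<forall>Z. subspace Z \<and> dens Z <o \<kappa> \<longrightarrow>
           (\<exists>x. \<forall>z\<in>Z. \<forall>c. R (norm (z + c *\<^sub>R x)) (norm (J z + c *\<^sub>R v))))"
    (is "?ideal \<longleftrightarrow> ?vector")
proof
  assume ideal: ?ideal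
  show ?vector
  proof (intro allI impI)
    fix Z :: "'a set"
    assume Z: "subspace Z \<and> dens Z <o \<kappa>"
    define E where "E = {y + c *\<^sub>R v | y c. y \<in> J ` Z}"
    have JZ: "subspace (J ` Z)"
      using linear_subspace_image[OF linear_J] Z by blast
    have memE: "J z + c *\<^sub>R v \<in> E" if "z \<in> Z" for z c
      using that unfolding E_def by blast
    have "subspace E"
    proof -
      have "{y + c *\<^sub>R v | y c. y \<in> J ` Z} = {y + u | y u. y \<in> J ` Z \<and> u \<in> range (\<lambda>c. c *\<^sub>R v)}"
        by blast
      then show ?thesis
        unfolding E_def using subspace_sums[OF JZ subspace_span[of "{v}"]] by (simp add: span_singleton)
    qed
    moreover have "dens E <o \<kappa>"
      unfolding E_def using Z JZ by (intro dens_add_line_less dens_image_less bounded_linear_J assms subspace_0) auto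
    ultimately obtain T where T: "linear_map_on E T" "T ` E \<subseteq> range J"
        "\<And>e. e \<in> E \<inter> range J \<Longrightarrow> T e = e" "\<And>e. e \<in> E \<Longrightarrow> R (norm (T e)) (norm e)"
      using ideal by blast
    have v: "v \<in> E"
      using memE[of 0 1] Z by (simp add: subspace_0 J.zero)
    then obtain x where x: "T v = J x"
      using T(2) by blast
    have "R (norm (z + c *\<^sub>R x)) (norm (J z + c *\<^sub>R v))" if z: "z \<in> Z" for z c
    proof -
      have "J z \<in> E" "c *\<^sub>R v \<in> E"
        using memE[OF z, of 0] memE[of 0 c] Z by (simp_all add: subspace_0 J.zero)
      then have "T (J z + c *\<^sub>R v) = J z + c *\<^sub>R J x"
        using T(1,3) v x unfolding linear_map_on_def by (metis IntI rangeI)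
      then have "norm (T (J z + c *\<^sub>R v)) = norm (z + c *\<^sub>R x)"
        by (metis J.add J.scale norm_J)
      then show ?thesis
        using T(4)[OF memE[OF z, of c]] by simp
    qed
    then show "\<exists>x. \<forall>z\<in>Z. \<forall>c. R (norm (z + c *\<^sub>R x)) (norm (J z + c *\<^sub>R v))"
      by blast
  qed
next
  assume vector: ?vector
  show ?ideal
  proof (intro allI impI)
    fix E :: "'w set"
    assume E: "subspace E \<and> dens E <o \<kappa>"
    then have "subspace (P ` E) \<and> dens (P ` E) <o \<kappa>"
      using linear_subspace_image[OF P.linear_axioms] dens_image_less[OF bounded_linear_P] by blast
    then obtain x where x: "\<And>z c. z \<in> P ` E \<Longrightarrow> R (norm (z + c *\<^sub>R x)) (norm (J z + c *\<^sub>R v))"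
      using vector by meson
    let ?T = "\<lambda>e. J (P e + q e *\<^sub>R x)"
    have "linear_map_on E ?T"
      by (simp add: linear_map_on_def P.add q.add J.add P.scale q.scale J.scale algebra_simps)
    moreover have "\<forall>e\<in>E \<inter> range J. ?T e = e"
      by (auto simp: P_J q_J)
    moreover have "\<forall>e\<in>E. R (norm (?T e)) (norm e)"
      using x[OF imageI] by (metis norm_J decomp)
    ultimately show "\<exists>T. linear_map_on E T \<and> T ` E \<subseteq> range J \<and> (\<forall>e\<in>E \<inter> range J. T e = e) \<and>
        (\<forall>e\<in>E. R (norm (T e)) (norm e))"
      by (intro exI[of _ ?T]) auto
  qed
qed

end

interpretation linf: line_extension
  "\<lambda>x::'a::real_normed_vector. Linf x (0::real)" "Linf 0 1" linf_fst linf_snd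
proof
  show "\<exists>K. \<forall>p::('a, real) linf_sum. norm (linf_fst p) \<le> norm p * K"
    by (rule exI[of _ 1]) (simp add: norm_linf_sum_def)
qed (simp_all add: plus_linf_sum_def scaleR_linf_sum_def norm_linf_sum_def)

interpretation l1: line_extension
  "\<lambda>x::'a::real_normed_vector. L1 x (0::real)" "L1 0 1" l1_fst l1_snd
proof
  show "\<exists>K. \<forall>p::('a, real) l1_sum. norm (l1_fst p) \<le> norm p * K"
    by (rule exI[of _ 1]) (simp add: norm_l1_sum_def)
qed (simp_all add: plus_l1_sum_def scaleR_l1_sum_def norm_l1_sum_def)

lemma norm_linf_coordinates: "norm (Linf z 0 + c *\<^sub>R Linf 0 (1::real)) = max (norm z) \<bar>c\<bar>"
  by (simp add: norm_linf_sum_def plus_linf_sum_def scaleR_linf_sum_def)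

lemma norm_l1_coordinates: "norm (L1 z 0 + c *\<^sub>R L1 0 (1::real)) = norm z + \<bar>c\<bar>"
  by (simp add: norm_l1_sum_def plus_l1_sum_def scaleR_l1_sum_def)

section \<open>The conditions on the added vector\<close>

lemma norm_eq_max:
  fixes x z :: "'a::real_normed_vector"
  assumes "norm x = 1"
    and plus: "norm (z + c *\<^sub>R x) \<le> max (norm z) \<bar>c\<bar>"
    and minus: "norm (z - c *\<^sub>R x) \<le> max (norm z) \<bar>c\<bar>"
  shows "norm (z + c *\<^sub>R x) = max (norm z) \<bar>c\<bar>"
proof -
  have "2 *\<^sub>R z = (z + c *\<^sub>R x) + (z - c *\<^sub>R x)"
    by (simp add: scaleR_2)
  then have "2 * norm z \<le> norm (z + c *\<^sub>R x) + norm (z - c *\<^sub>R x)"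
    using norm_triangle_ineq[of "z + c *\<^sub>R x" "z - c *\<^sub>R x"]
    by (metis norm_scaleR abs_numeral)
  moreover have "(2 * c) *\<^sub>R x = (z + c *\<^sub>R x) - (z - c *\<^sub>R x)"
    by (simp add: scaleR_2 flip: scaleR_scaleR)
  then have "2 * \<bar>c\<bar> \<le> norm (z + c *\<^sub>R x) + norm (z - c *\<^sub>R x)"
    using norm_triangle_ineq4[of "z + c *\<^sub>R x" "z - c *\<^sub>R x"] assms(1)
    by (metis norm_scaleR abs_mult abs_numeral mult.right_neutral)
  ultimately show ?thesis
    using plus minus by linarith
qed

lemma square_vector_iff:
  fixes Z :: "'a::real_normed_vector set"
  assumes "0 \<in> Z"
  shows "(\<exists>x\<in>sphere 0 1. \<forall>z\<in>Z. \<forall>c::real. norm (z + c *\<^sub>R x) \<le> max (norm z) \<bar>c\<bar>) \<longleftrightarrow>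
         (\<exists>x. \<forall>z\<in>Z. \<forall>c::real. norm (z + c *\<^sub>R x) = max (norm z) \<bar>c\<bar>)"
    (is "?L \<longleftrightarrow> ?R")
proof
  assume ?L
  then obtain x where x: "norm x = 1"
      "\<And>z c. z \<in> Z \<Longrightarrow> norm (z + c *\<^sub>R x) \<le> max (norm z) \<bar>c :: real\<bar>"
    by auto
  have "norm (z + c *\<^sub>R x) = max (norm z) \<bar>c\<bar>" if "z \<in> Z" for z c
    using x(2)[OF that, of c] x(2)[OF that, of "- c"] by (intro norm_eq_max x(1)) simp_all
  then show ?R by blast
next
  assume ?R
  then obtain x where x: "\<And>z c. z \<in> Z \<Longrightarrow> norm (z + c *\<^sub>R x) = max (norm z) \<bar>c :: real\<bar>"
    by blast
  have "norm x = 1"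
    using x[OF assms, of 1] by simp
  with x show ?L
    by (intro bexI[of _ x]) auto
qed

lemma l1_vector_iff:
  fixes Z :: "'a::real_normed_vector set"
  assumes "0 \<in> Z"
  shows "(\<exists>x\<in>sphere 0 1. \<forall>z\<in>Z. \<forall>c::real. norm (z + c *\<^sub>R x) = norm z + \<bar>c\<bar>) \<longleftrightarrow>
         (\<exists>x. \<forall>z\<in>Z. \<forall>c::real. norm (z + c *\<^sub>R x) = norm z + \<bar>c\<bar>)"
proof -
  have "norm x = 1" if "\<forall>z\<in>Z. \<forall>c::real. norm (z + c *\<^sub>R x) = norm z + \<bar>c\<bar>" for x
    using that[rule_format, OF assms, of 1] by simp
  then show ?thesis unfolding Bex_def mem_sphere_0 by blast
qed

text \<open>
  Dividing by \<open>\<parallel>y\<parallel> \<le> 1 + \<delta>\<close> turns the factor \<open>1 - \<delta>\<close> into \<open>(1 - \<delta>) / (1 + \<delta>)\<close>, which is at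
  least \<open>1 - 2 \<delta>\<close>.
\<close>

lemma normalize_l1_vector:
  fixes Z :: "'a::real_normed_vector set"
  assumes "0 \<in> Z" and \<delta>: "0 < \<delta>" "\<delta> < 1"
    and y: "\<And>z c. z \<in> Z \<Longrightarrow> (1 - \<delta>) * (norm z + \<bar>c\<bar>) \<le> norm (z + c *\<^sub>R y) \<and>
                             norm (z + c *\<^sub>R y) \<le> (1 + \<delta>) * (norm z + \<bar>c\<bar>)"
  obtains x where "norm x = 1"
    "\<And>z c. z \<in> Z \<Longrightarrow> (1 - 2 * \<delta>) * (norm z + \<bar>c\<bar>) \<le> norm (z + c *\<^sub>R x)"
proof
  have ny: "1 - \<delta> \<le> norm y" "norm y \<le> 1 + \<delta>"
    using y[OF assms(1), of 1] by simp_all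
  then have pos: "norm y > 0"
    using \<delta> by linarith
  let ?x = "inverse (norm y) *\<^sub>R y"
  show "norm ?x = 1"
    using pos by simp
  show "(1 - 2 * \<delta>) * (norm z + \<bar>c\<bar>) \<le> norm (z + c *\<^sub>R ?x)" if z: "z \<in> Z" for z c
  proof -
    have "(1 - 2 * \<delta>) * (1 + \<delta>) \<le> 1 - \<delta>"
      by (simp add: algebra_simps)
    then have coeff: "1 - 2 * \<delta> \<le> (1 - \<delta>) / (1 + \<delta>)"
      using \<delta> by (subst pos_le_divide_eq) simp_all
    have "norm z + \<bar>c\<bar> \<le> (1 + \<delta>) * (norm z + \<bar>c\<bar> / norm y)"
    proof -
      have "\<bar>c\<bar> \<le> (1 + \<delta>) * (\<bar>c\<bar> / norm y)"
        using mult_right_mono[OF ny(2), of "\<bar>c\<bar>"] pos by (simp add: pos_le_divide_eq mult.commute)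
      moreover have "norm z \<le> (1 + \<delta>) * norm z"
        using \<delta> by (simp add: algebra_simps)
      ultimately show ?thesis
        by (simp add: distrib_left)
    qed
    then have scaled: "(norm z + \<bar>c\<bar>) / (1 + \<delta>) \<le> norm z + \<bar>c\<bar> / norm y"
      using \<delta> by (simp add: pos_divide_le_eq mult.commute)
    have "(1 - 2 * \<delta>) * (norm z + \<bar>c\<bar>) \<le> (1 - \<delta>) / (1 + \<delta>) * (norm z + \<bar>c\<bar>)"
      using coeff by (rule mult_right_mono) simp
    also have "\<dots> = (1 - \<delta>) * ((norm z + \<bar>c\<bar>) / (1 + \<delta>))"
      by simp
    also have "\<dots> \<le> (1 - \<delta>) * (norm z + \<bar>c\<bar> / norm y)"
      using scaled \<delta> by (intro mult_left_mono) simp_all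
    also have "\<dots> \<le> norm (z + (c / norm y) *\<^sub>R y)"
      using y[OF z, of "c / norm y"] by simp
    also have "\<dots> = norm (z + c *\<^sub>R ?x)"
      by (simp add: divide_inverse)
    finally show ?thesis .
  qed
qed

lemma octahedral_vector_iff:
  fixes Z :: "'a::real_normed_vector set"
  assumes "0 \<in> Z"
  shows "(\<forall>\<epsilon>>0. \<exists>x\<in>sphere 0 1. \<forall>z\<in>Z. \<forall>c::real. norm (z + c *\<^sub>R x) \<ge> (1 - \<epsilon>) * (norm z + \<bar>c\<bar>)) \<longleftrightarrow>
         (\<forall>\<epsilon>>0. \<exists>x. \<forall>z\<in>Z. \<forall>c::real. (1 - \<epsilon>) * (norm z + \<bar>c\<bar>) \<le> norm (z + c *\<^sub>R x) \<and>
                                     norm (z + c *\<^sub>R x) \<le> (1 + \<epsilon>) * (norm z + \<bar>c\<bar>))"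
    (is "?L \<longleftrightarrow> ?R")
proof
  assume L: ?L
  have upper: "norm (z + c *\<^sub>R x) \<le> (1 + \<epsilon>) * (norm z + \<bar>c\<bar>)"
    if "norm x = 1" "\<epsilon> > 0" for \<epsilon> c :: real and x z :: 'a
  proof -
    have "norm (z + c *\<^sub>R x) \<le> norm z + \<bar>c\<bar>"
      using norm_triangle_ineq[of z "c *\<^sub>R x"] that by simp
    also have "\<dots> \<le> (1 + \<epsilon>) * (norm z + \<bar>c\<bar>)"
      using that by (simp add: distrib_right)
    finally show ?thesis .
  qed
  show ?R
  proof (intro allI impI)
    fix \<epsilon> :: real
    assume "\<epsilon> > 0"
    with L obtain x where "norm x = 1"
        "\<forall>z\<in>Z. \<forall>c::real. norm (z + c *\<^sub>R x) \<ge> (1 - \<epsilon>) * (norm z + \<bar>c\<bar>)"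
      by (metis mem_sphere_0)
    then show "\<exists>x. \<forall>z\<in>Z. \<forall>c::real. (1 - \<epsilon>) * (norm z + \<bar>c\<bar>) \<le> norm (z + c *\<^sub>R x) \<and>
        norm (z + c *\<^sub>R x) \<le> (1 + \<epsilon>) * (norm z + \<bar>c\<bar>)"
      using upper \<open>\<epsilon> > 0\<close> by blast
  qed
next
  assume R: ?R
  show ?L
  proof (intro allI impI)
    fix \<epsilon> :: real
    assume \<epsilon>: "\<epsilon> > 0"
    \<comment> \<open>The minimum with \<open>1\<close> keeps \<open>\<delta> < 1\<close>, so that the vector found below is nonzero.\<close>
    define \<delta> where "\<delta> = min \<epsilon> 1 / 2"
    have \<delta>: "0 < \<delta>" "\<delta> < 1" "2 * \<delta> \<le> \<epsilon>"
      using \<epsilon> by (auto simp: \<delta>_def)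
    then obtain y where "\<And>z c. z \<in> Z \<Longrightarrow> (1 - \<delta>) * (norm z + \<bar>c\<bar>) \<le> norm (z + c *\<^sub>R y) \<and>
        norm (z + c *\<^sub>R y) \<le> (1 + \<delta>) * (norm z + \<bar>c\<bar>)"
      using R by meson
    with assms \<delta> obtain x where x: "norm x = 1"
        "\<And>z c. z \<in> Z \<Longrightarrow> (1 - 2 * \<delta>) * (norm z + \<bar>c\<bar>) \<le> norm (z + c *\<^sub>R x)"
      using normalize_l1_vector by metis
    have "(1 - \<epsilon>) * (norm z + \<bar>c\<bar>) \<le> norm (z + c *\<^sub>R x)" if "z \<in> Z" for z c
    proof -
      have "(1 - \<epsilon>) * (norm z + \<bar>c\<bar>) \<le> (1 - 2 * \<delta>) * (norm z + \<bar>c\<bar>)"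
        using \<delta> by (intro mult_right_mono) simp_all
      then show ?thesis
        using x(2)[OF that, of c] by linarith
    qed
    with x(1) show "\<exists>x\<in>sphere 0 1. \<forall>z\<in>Z. \<forall>c::real.
        norm (z + c *\<^sub>R x) \<ge> (1 - \<epsilon>) * (norm z + \<bar>c\<bar>)"
      by (intro bexI[of _ x]) auto
  qed
qed

section \<open>The three equivalences\<close>

theorem theorem4p16:
  fixes \<kappa> :: "'k rel"
  assumes "Card_order \<kappa>" and "infinite (Field \<kappa>)"
  shows "(SQ_less TYPE('a::banach) \<kappa> \<longleftrightarrow>
            isometric_ideal \<kappa> {Linf x (0::real) | x :: 'a. True}) \<and>
         (octahedral_less TYPE('a) \<kappa> \<longleftrightarrow>
            almost_isometric_ideal \<kappa> {L1 x (0::real) | x :: 'a. True}) \<and>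
         (fails_minus_one_BCP_less TYPE('a) \<kappa> \<longleftrightarrow>
            isometric_ideal \<kappa> {L1 x (0::real) | x :: 'a. True})"
proof -
  let ?Jinf = "\<lambda>x::'a. Linf x (0::real)" and ?J1 = "\<lambda>x::'a. L1 x (0::real)"
  have ranges: "{Linf x (0::real) | x :: 'a. True} = range ?Jinf"
      "{L1 x (0::real) | x :: 'a. True} = range ?J1"
    by blast+
  have subspaces: "subspace (range ?Jinf)" "subspace (range ?J1)"
    using linear_subspace_image[OF linf.linear_J subspace_UNIV] linear_subspace_image[OF l1.linear_J subspace_UNIV]
    by blast+
  have "SQ_less TYPE('a) \<kappa> \<longleftrightarrow> isometric_ideal \<kappa> (range ?Jinf)"
  proof -
    have "SQ_less TYPE('a) \<kappa> \<longleftrightarrow> (\<forall>Z :: 'a set. subspace Z \<and> dens Z <o \<kappa> \<longrightarrow>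
        (\<exists>x. \<forall>z\<in>Z. \<forall>c::real. norm (z + c *\<^sub>R x) = max (norm z) \<bar>c\<bar>))"
      unfolding SQ_less_def
      by (rule all_cong1, rule imp_cong[OF refl], rule square_vector_iff, blast intro: subspace_0)
    then show ?thesis
      using linf.ideal_iff_vector[OF assms, where R = "(=)" and 'a = 'a] subspaces(1)
      by (simp only: isometric_ideal_def norm_linf_coordinates simp_thms)
  qed
  moreover have "octahedral_less TYPE('a) \<kappa> \<longleftrightarrow> almost_isometric_ideal \<kappa> (range ?J1)"
  proof -
    have "octahedral_less TYPE('a) \<kappa> \<longleftrightarrow> (\<forall>Z :: 'a set. subspace Z \<and> dens Z <o \<kappa> \<longrightarrow>
        (\<forall>\<epsilon>>0. \<exists>x\<in>sphere 0 1. \<forall>z\<in>Z. \<forall>c::real. norm (z + c *\<^sub>R x) \<ge> (1 - \<epsilon>) * (norm z + \<bar>c\<bar>)))"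
      unfolding octahedral_less_def by blast
    also have "\<dots> \<longleftrightarrow> (\<forall>Z :: 'a set. subspace Z \<and> dens Z <o \<kappa> \<longrightarrow>
        (\<forall>\<epsilon>>0. \<exists>x. \<forall>z\<in>Z. \<forall>c::real. (1 - \<epsilon>) * (norm z + \<bar>c\<bar>) \<le> norm (z + c *\<^sub>R x) \<and>
                                     norm (z + c *\<^sub>R x) \<le> (1 + \<epsilon>) * (norm z + \<bar>c\<bar>)))"
      by (rule all_cong1, rule imp_cong[OF refl], rule octahedral_vector_iff, blast intro: subspace_0)
    also have "\<dots> \<longleftrightarrow> (\<forall>\<epsilon>>0. \<forall>Z :: 'a set. subspace Z \<and> dens Z <o \<kappa> \<longrightarrow>
        (\<exists>x. \<forall>z\<in>Z. \<forall>c::real. (1 - \<epsilon>) * (norm z + \<bar>c\<bar>) \<le> norm (z + c *\<^sub>R x) \<and>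
                               norm (z + c *\<^sub>R x) \<le> (1 + \<epsilon>) * (norm z + \<bar>c\<bar>)))"
      by blast
    also have "\<dots> \<longleftrightarrow> (\<forall>\<epsilon>>0. \<forall>E. subspace E \<and> dens E <o \<kappa> \<longrightarrow>
        (\<exists>T. linear_map_on E T \<and> T ` E \<subseteq> range ?J1 \<and> (\<forall>e\<in>E \<inter> range ?J1. T e = e) \<and>
             (\<forall>e\<in>E. (1 - \<epsilon>) * norm e \<le> norm (T e) \<and> norm (T e) \<le> (1 + \<epsilon>) * norm e)))"
      using l1.ideal_iff_vector[OF assms, where 'a = 'a and
          R = "\<lambda>s t. (1 - \<epsilon>) * t \<le> s \<and> s \<le> (1 + \<epsilon>) * t" for \<epsilon>]
      by (simp only: norm_l1_coordinates)
    also have "\<dots> \<longleftrightarrow> almost_isometric_ideal \<kappa> (range ?J1)"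
      unfolding almost_isometric_ideal_def using subspaces(2) by blast
    finally show ?thesis .
  qed
  moreover have "fails_minus_one_BCP_less TYPE('a) \<kappa> \<longleftrightarrow> isometric_ideal \<kappa> (range ?J1)"
  proof -
    have "fails_minus_one_BCP_less TYPE('a) \<kappa> \<longleftrightarrow> (\<forall>Z :: 'a set. subspace Z \<and> dens Z <o \<kappa> \<longrightarrow>
        (\<exists>x. \<forall>z\<in>Z. \<forall>c::real. norm (z + c *\<^sub>R x) = norm z + \<bar>c\<bar>))"
      unfolding fails_minus_one_BCP_less_def
      by (rule all_cong1, rule imp_cong[OF refl], rule l1_vector_iff, blast intro: subspace_0)
    then show ?thesis
      using l1.ideal_iff_vector[OF assms, where R = "(=)" and 'a = 'a] subspaces(2)
      by (simp only: isometric_ideal_def norm_l1_coordinates simp_thms)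
  qed
  ultimately show ?thesis
    unfolding ranges by blast
qed

end
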